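(* Suppose $0\in Y_k$ for all $k$, and let $q^*_{k,i}=\min\{(G_kx)_i:\ x\in X\}$ for all $i$ and $k$, with $q^*_k=(q^*_{k,i})_i$. If $q^*_k>-\infty$ (componentwise) and $f_k\ge 0$ for all $k$, then the linear model $$\min\Big\{cx+\sum_{k=1}^K\pi_kf_ky_k:\ Ax\ge b,\ \sum_{k=1}^K\pi_kz_k\le\varepsilon,\ G_kx+H_ky_k+(h_k-q^*_k)z_k\ge h_k\ \ \forall k,\ x\in\mathbb{R}^{n_1}_+\times\mathbb{Z}^{n_2}_+,\ y_k\in Y_k,\ z_k\in\{0,1\}\ \ \forall k\Big\}$$ is a valid formulation of the chance constrained program $\mathbf{CC\text{-}MIBP}$; in particular its optimal value is $\theta^*(\varepsilon)$.
   Context: Data: scenarios $k=1,\dots,K$ with probabilities $\pi_k\ge 0$, $\sum_k\pi_k=1$; risk tolerance $\varepsilon\in[0,1]$; real matrices and vectors $A,b,c$ and $G_k,H_k,h_k,f_k$ of compatible dimensions. $X=\{x\in\mathbb{R}^{n_1}_+\times\mathbb{Z}^{n_2}_+:\ Ax\ge b\}$ is assumed nonempty. $Y_k\subseteq\mathbb{R}^m_+$ is the set defined by the variable bounds of the recourse vector $y_k$ ($Y_k=\mathbb{R}^m_+$ if the only bounds are nonnegativity). The program $\mathbf{CC\text{-}MIBP}$ is $$\theta^*(\varepsilon)=\min\ cx+\sum_{k=1}^K\pi_k\eta_k$$ subject to $Ax\ge b$; $\eta_k=(f_ky_k)(1-z_k)$ and $(G_kx+H_ky_k-h_k)(1-z_k)\ge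 0$ (componentwise) for $k=1,\dots,K$; $\sum_k\pi_kz_k\le\varepsilon$; $x\in\mathbb{R}^{n_1}_+\times\mathbb{Z}^{n_2}_+$, $y_k\in Y_k$, $z_k\in\{0,1\}$. Optimal values (including the "min" defining $q^*_{k,i}$) are infima, $+\infty$ if infeasible and $-\infty$ if unbounded. A model is a valid formulation of the chance constrained program if a first-stage vector $x$ can be extended to a feasible solution of the model if and only if it can be extended to a feasible solution of $\mathbf{CC\text{-}MIBP}$, and the two optimal values coincide. *)

theory Defs
  imports
    "Jordan_Normal_Form.Matrix"
    "HOL-Library.Extended_Real"
    Complex_Main
begin

text \<open>
  A vector \<open>x\<close> of dimension \<open>n_cont + n_int\<close> stands for an element of
  \<open>\<real>^n_cont \<times> \<int>^n_int\<close>: its first \<open>n_cont\<close> entries are continuous, the remaining ones integral.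
  Scenarios are indexed by \<open>1, \<dots>, n_scen\<close>; values of scenario-indexed data at other indices
  play no role. The number of rows of \<open>G_mat k\<close> may depend on \<open>k\<close>. The bounds on
  \<open>y\<^sub>k\<close> are extended reals, so that a missing bound is infinite.
\<close>

record cc_data =
  n_cont :: nat
  n_int :: nat
  n_rec :: nat
  n_scen :: nat
  A_mat :: "real mat"
  b_vec :: "real vec"
  c_vec :: "real vec"
  G_mat :: "nat \<Rightarrow> real mat"
  H_mat :: "nat \<Rightarrow> real mat"
  h_vec :: "nat \<Rightarrow> real vec"
  f_vec :: "nat \<Rightarrow> real vec"
  y_lower :: "nat \<Rightarrow> nat \<Rightarrow> ereal"
  y_upper :: "nat \<Rightarrow> nat \<Rightarrow> ereal"
  scen_prob :: "nat \<Rightarrow> real"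

definition n_first :: "cc_data \<Rightarrow> nat" where
  "n_first D = n_cont D + n_int D"

definition scenarios :: "cc_data \<Rightarrow> nat set" where
  "scenarios D = {1..n_scen D}"

definition compatible_dims :: "cc_data \<Rightarrow> bool" where
  "compatible_dims D \<longleftrightarrow>
     A_mat D \<in> carrier_mat (dim_row (A_mat D)) (n_first D) \<and>
     b_vec D \<in> carrier_vec (dim_row (A_mat D)) \<and>
     c_vec D \<in> carrier_vec (n_first D) \<and>
     (\<forall>k\<in>scenarios D.
        G_mat D k \<in> carrier_mat (dim_row (G_mat D k)) (n_first D) \<and>
        H_mat D k \<in> carrier_mat (dim_row (G_mat D k)) (n_rec D) \<and>
        h_vec D k \<in> carrier_vec (dim_row (G_mat D k)) \<and>
        f_vec D k \<in> carrier_vec (n_rec D))"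

definition scen_distribution :: "cc_data \<Rightarrow> bool" where
  "scen_distribution D \<longleftrightarrow>
     (\<forall>k\<in>scenarios D. 0 \<le> scen_prob D k) \<and> (\<Sum>k\<in>scenarios D. scen_prob D k) = 1"

definition first_stage_domain :: "cc_data \<Rightarrow> real vec set" where
  "first_stage_domain D =
     {x \<in> carrier_vec (n_first D). 0\<^sub>v (n_first D) \<le> x \<and>
        (\<forall>j\<in>{n_cont D..<n_first D}. x $ j \<in> \<int>)}"

definition X_set :: "cc_data \<Rightarrow> real vec set" where
  "X_set D = {x \<in> first_stage_domain D. b_vec D \<le> A_mat D *\<^sub>v x}"

definition Y_set :: "cc_data \<Rightarrow> nat \<Rightarrow> real vec set" where
  "Y_set D k =
     {y \<in> carrier_vec (n_rec D). 0\<^sub>v (n_rec D) \<le> y \<and>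
        (\<forall>j<n_rec D. y_lower D k j \<le> ereal (y $ j) \<and> ereal (y $ j) \<le> y_upper D k j)}"

text \<open>
  A minimization model, whose solutions are pairs of a first-stage vector and the remaining
  variables. By the conventions on \<open>INF\<close> in \<^typ>\<open>ereal\<close>, the optimal value is \<open>\<infinity>\<close> for an
  infeasible and \<open>-\<infinity>\<close> for an unbounded model.
\<close>

record 'r min_model =
  feasible :: "(real vec \<times> 'r) set"
  objective :: "real vec \<times> 'r \<Rightarrow> real"

definition optimal_value :: "'r min_model \<Rightarrow> ereal" where
  "optimal_value M = (INF s\<in>feasible M. ereal (objective M s))"

definition valid_formulation :: "'r min_model \<Rightarrow> 's min_model \<Rightarrow> bool" where
  "valid_formulation M P \<longleftrightarrow>
     (\<forall>x. (\<exists>r. (x, r) \<in> feasible M) \<longleftrightarrow> (\<exists>s. (x, s) \<in> feasible P)) \<and>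
     optimal_value M = optimal_value P"

definition CC_MIBP ::
  "cc_data \<Rightarrow> real \<Rightarrow>
    ((nat \<Rightarrow> real vec) \<times> (nat \<Rightarrow> real) \<times> (nat \<Rightarrow> real)) min_model" where
  "CC_MIBP D \<epsilon> =
     \<lparr> feasible = {(x, y, z, \<eta>).
         x \<in> first_stage_domain D \<and>
         b_vec D \<le> A_mat D *\<^sub>v x \<and>
         (\<Sum>k\<in>scenarios D. scen_prob D k * z k) \<le> \<epsilon> \<and>
         (\<forall>k\<in>scenarios D.
            y k \<in> Y_set D k \<and> z k \<in> {0, 1} \<and>
            \<eta> k = (f_vec D k \<bullet> y k) * (1 - z k) \<and>
            0\<^sub>v (dim_row (G_mat D k)) \<le>
              (1 - z k) \<cdot>\<^sub>v (G_mat D k *\<^sub>v x + H_mat D k *\<^sub>v y k - h_vec D k))},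
       objective = (\<lambda>(x, y, z, \<eta>). c_vec D \<bullet> x + (\<Sum>k\<in>scenarios D. scen_prob D k * \<eta> k)) \<rparr>"

definition theta :: "cc_data \<Rightarrow> real \<Rightarrow> ereal" where
  "theta D \<epsilon> = optimal_value (CC_MIBP D \<epsilon>)"

definition q_star :: "cc_data \<Rightarrow> nat \<Rightarrow> nat \<Rightarrow> ereal" where
  "q_star D k i = (INF x\<in>X_set D. ereal ((G_mat D k *\<^sub>v x) $ i))"

text \<open>\<open>real_of_ereal\<close> maps infinite values to 0, so this is meaningful only if all
  \<open>q_star D k i\<close> are finite.\<close>

definition q_star_vec :: "cc_data \<Rightarrow> nat \<Rightarrow> real vec" where
  "q_star_vec D k = vec (dim_row (G_mat D k)) (\<lambda>i. real_of_ereal (q_star D k i))"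

definition linear_model ::
  "cc_data \<Rightarrow> real \<Rightarrow> ((nat \<Rightarrow> real vec) \<times> (nat \<Rightarrow> real)) min_model" where
  "linear_model D \<epsilon> =
     \<lparr> feasible = {(x, y, z).
         x \<in> first_stage_domain D \<and>
         b_vec D \<le> A_mat D *\<^sub>v x \<and>
         (\<Sum>k\<in>scenarios D. scen_prob D k * z k) \<le> \<epsilon> \<and>
         (\<forall>k\<in>scenarios D.
            y k \<in> Y_set D k \<and> z k \<in> {0, 1} \<and>
            h_vec D k \<le>
              G_mat D k *\<^sub>v x + H_mat D k *\<^sub>v y k + z k \<cdot>\<^sub>v (h_vec D k - q_star_vec D k))},
       objective = (\<lambda>(x, y, z). c_vec D \<bullet> x +
         (\<Sum>k\<in>scenarios D. scen_prob D k * (f_vec D k \<bullet> y k))) \<rparr>"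

end

theory Submission
  imports Defs
begin

text \<open>
  A solution of either model is turned into one of the other with the same \<open>x\<close> and \<open>z\<close> and no larger
  objective value. The two models impose the same constraints on scenarios with \<open>z\<^sub>k = 0\<close>. If
  \<open>z\<^sub>k = 1\<close>, the bilinear model charges nothing, which costs at most \<open>f\<^sub>k y\<^sub>k \<ge> 0\<close>; conversely, the
  linear model then admits \<open>y\<^sub>k = 0\<close>, its constraint becoming \<open>G\<^sub>k x \<ge> q\<^sup>*\<^sub>k\<close>, which holds on \<open>X\<close>.
\<close>

text \<open>Each infimum is bounded by the other because every solution is matched by one that is no
  worse. No optimum has to be attained, so infeasible and unbounded models are covered.\<close>

lemma valid_formulationI:
  assumes "\<And>x r. (x, r) \<in> feasible M \<Longrightarrow> \<exists>s. (x, s) \<in> feasible P \<and> objective P (x, s) \<le> objective M (x, r)"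
    and "\<And>x s. (x, s) \<in> feasible P \<Longrightarrow> \<exists>r. (x, r) \<in> feasible M \<and> objective M (x, r) \<le> objective P (x, s)"
  shows "valid_formulation M P"
proof -
  have "optimal_value P \<le> optimal_value M"
    unfolding optimal_value_def by (rule INF_mono) (use assms(1) in fastforce)
  moreover have "optimal_value M \<le> optimal_value P"
    unfolding optimal_value_def by (rule INF_mono) (use assms(2) in fastforce)
  ultimately show ?thesis
    unfolding valid_formulation_def using assms by (blast intro: antisym)
qed

lemma scalar_prod_nonneg:
  fixes v w :: "real vec"
  assumes "0\<^sub>v n \<le> v" "0\<^sub>v n \<le> w"
  shows "0 \<le> v \<bullet> w"
  using assms by (auto simp: scalar_prod_def less_eq_vec_def intro!: sum_nonneg)

text \<open>The point \<open>x\<close> keeps the infimum below \<infinity>, so it is finite and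
  \<open>real_of_ereal\<close> returns its true value instead of the default 0.\<close>

lemma q_star_vec_le:
  assumes "x \<in> X_set D" "i < dim_row (G_mat D k)" "q_star D k i > -\<infinity>"
  shows "q_star_vec D k $ i \<le> (G_mat D k *\<^sub>v x) $ i"
proof -
  have "q_star D k i \<le> ereal ((G_mat D k *\<^sub>v x) $ i)"
    unfolding q_star_def using assms(1) by (rule INF_lower)
  then show ?thesis
    using assms(2,3) by (cases "q_star D k i") (auto simp: q_star_vec_def)
qed

text \<open>Only \<eta> has to be supplied, and its defining equation forces the choice. When
  \<open>z k = 1\<close>, the bilinear constraint reads 0 \<le> 0.\<close>

lemma CC_MIBP_solution_from_linear_model:
  assumes dims: "compatible_dims D"
    and prob: "\<forall>k\<in>scenarios D. 0 \<le> scen_prob D k"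
    and f: "\<forall>k\<in>scenarios D. 0\<^sub>v (n_rec D) \<le> f_vec D k"
    and feas: "(x, y, z) \<in> feasible (linear_model D \<epsilon>)"
  defines "\<eta> \<equiv> \<lambda>k. (f_vec D k \<bullet> y k) * (1 - z k)"
  shows "(x, y, z, \<eta>) \<in> feasible (CC_MIBP D \<epsilon>)"
    and "objective (CC_MIBP D \<epsilon>) (x, y, z, \<eta>) \<le> objective (linear_model D \<epsilon>) (x, y, z)"
proof -
  have "0\<^sub>v (dim_row (G_mat D k)) \<le>
      (1 - z k) \<cdot>\<^sub>v (G_mat D k *\<^sub>v x + H_mat D k *\<^sub>v y k - h_vec D k)"
    if k: "k \<in> scenarios D" for k
  proof -
    \<comment> \<open>The order on vectors includes equality of dimensions, so these are needed
      before comparing entries.\<close>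
    have "dim_row (H_mat D k) = dim_row (G_mat D k)" "dim_vec (h_vec D k) = dim_row (G_mat D k)"
      using dims k by (auto simp: compatible_dims_def)
    moreover have "z k \<in> {0, 1}"
      "h_vec D k \<le> G_mat D k *\<^sub>v x + H_mat D k *\<^sub>v y k + z k \<cdot>\<^sub>v (h_vec D k - q_star_vec D k)"
      using feas k by (auto simp: linear_model_def)
    ultimately show ?thesis
      by (auto simp: less_eq_vec_def q_star_vec_def)
  qed
  then show "(x, y, z, \<eta>) \<in> feasible (CC_MIBP D \<epsilon>)"
    using feas by (auto simp: CC_MIBP_def linear_model_def \<eta>_def)
  have "\<eta> k \<le> f_vec D k \<bullet> y k" if k: "k \<in> scenarios D" for k
  proof -
    have "0 \<le> f_vec D k \<bullet> y k" "z k \<in> {0, 1}"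
      using f feas k by (auto simp: linear_model_def Y_set_def intro!: scalar_prod_nonneg)
    then show ?thesis
      by (auto simp: \<eta>_def)
  qed
  then show "objective (CC_MIBP D \<epsilon>) (x, y, z, \<eta>) \<le> objective (linear_model D \<epsilon>) (x, y, z)"
    using prob by (auto simp: CC_MIBP_def linear_model_def intro!: sum_mono mult_left_mono)
qed

lemma linear_model_solution_from_CC_MIBP:
  assumes dims: "compatible_dims D"
    and zero: "\<forall>k\<in>scenarios D. 0\<^sub>v (n_rec D) \<in> Y_set D k"
    and q: "\<forall>k\<in>scenarios D. \<forall>i<dim_row (G_mat D k). q_star D k i > -\<infinity>"
    and feas: "(x, y, z, \<eta>) \<in> feasible (CC_MIBP D \<epsilon>)"
  \<comment> \<open>Where \<open>z k = 1\<close>, the bilinear model leaves \<open>y k\<close> free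
    within its bounds, so it may violate the linear constraint or cost too much; it is reset to
    zero.\<close>
  defines "y' \<equiv> \<lambda>k. if z k = 0 then y k else 0\<^sub>v (n_rec D)"
  shows "(x, y', z) \<in> feasible (linear_model D \<epsilon>)"
    and "objective (linear_model D \<epsilon>) (x, y', z) = objective (CC_MIBP D \<epsilon>) (x, y, z, \<eta>)"
proof -
  have X: "x \<in> X_set D"
    using feas by (auto simp: CC_MIBP_def X_set_def)
  have "h_vec D k \<le> G_mat D k *\<^sub>v x + H_mat D k *\<^sub>v y' k + z k \<cdot>\<^sub>v (h_vec D k - q_star_vec D k)"
    if k: "k \<in> scenarios D" for k
  proof -
    have H: "H_mat D k \<in> carrier_mat (dim_row (G_mat D k)) (n_rec D)"
      and h: "dim_vec (h_vec D k) = dim_row (G_mat D k)"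
      using dims k by (auto simp: compatible_dims_def)
    have z: "z k \<in> {0, 1}"
      and c: "0\<^sub>v (dim_row (G_mat D k)) \<le>
        (1 - z k) \<cdot>\<^sub>v (G_mat D k *\<^sub>v x + H_mat D k *\<^sub>v y k - h_vec D k)"
      using feas k by (auto simp: CC_MIBP_def)
    show ?thesis
    proof (cases "z k = 0")
      case True
      then show ?thesis
        using c H h by (auto simp: less_eq_vec_def q_star_vec_def y'_def)
    next
      case False
      \<comment> \<open>Here \<open>z k = 1\<close> and \<open>y' k\<close> is zero, so
        \<open>h_vec D k\<close> cancels from both sides and exactly this bound remains.\<close>
      have "q_star_vec D k $ i \<le> (G_mat D k *\<^sub>v x) $ i" if "i < dim_row (G_mat D k)" for i
        using q_star_vec_le[OF X that] q k that by blast
      then show ?thesis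
        using False z H h by (auto simp: less_eq_vec_def q_star_vec_def y'_def)
    qed
  qed
  then show "(x, y', z) \<in> feasible (linear_model D \<epsilon>)"
    using feas zero by (auto simp: CC_MIBP_def linear_model_def y'_def)
  \<comment> \<open>Both costs vanish when \<open>z k = 1\<close> and equal the original recourse
    cost otherwise.\<close>
  have "f_vec D k \<bullet> y' k = \<eta> k" if k: "k \<in> scenarios D" for k
  proof -
    have "z k \<in> {0, 1}" "\<eta> k = (f_vec D k \<bullet> y k) * (1 - z k)" "f_vec D k \<in> carrier_vec (n_rec D)"
      using feas dims k by (auto simp: CC_MIBP_def compatible_dims_def)
    then show ?thesis
      by (auto simp: y'_def)
  qed
  then show "objective (linear_model D \<epsilon>) (x, y', z) = objective (CC_MIBP D \<epsilon>) (x, y, z, \<eta>)"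
    by (simp add: CC_MIBP_def linear_model_def)
qed

theorem proposition3:
  fixes D :: cc_data and \<epsilon> :: real
  assumes "compatible_dims D"
    and "scen_distribution D"
    and "0 \<le> \<epsilon>" and "\<epsilon> \<le> 1"
    and "X_set D \<noteq> {}"
    and "\<forall>k\<in>scenarios D. 0\<^sub>v (n_rec D) \<in> Y_set D k"
    and "\<forall>k\<in>scenarios D. \<forall>i<dim_row (G_mat D k). q_star D k i > -\<infinity>"
    and "\<forall>k\<in>scenarios D. 0\<^sub>v (n_rec D) \<le> f_vec D k"
  shows "valid_formulation (linear_model D \<epsilon>) (CC_MIBP D \<epsilon>) \<and>
         optimal_value (linear_model D \<epsilon>) = theta D \<epsilon>"
proof -
  have prob: "\<forall>k\<in>scenarios D. 0 \<le> scen_prob D k"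
    using assms(2) by (simp add: scen_distribution_def)
  have "valid_formulation (linear_model D \<epsilon>) (CC_MIBP D \<epsilon>)"
  proof (rule valid_formulationI)
    fix x r
    assume "(x, r) \<in> feasible (linear_model D \<epsilon>)"
    then show "\<exists>s. (x, s) \<in> feasible (CC_MIBP D \<epsilon>) \<and>
        objective (CC_MIBP D \<epsilon>) (x, s) \<le> objective (linear_model D \<epsilon>) (x, r)"
      using CC_MIBP_solution_from_linear_model[OF assms(1) prob assms(8)] by (cases r) blast
  next
    fix x s
    assume "(x, s) \<in> feasible (CC_MIBP D \<epsilon>)"
    then show "\<exists>r. (x, r) \<in> feasible (linear_model D \<epsilon>) \<and>
        objective (linear_model D \<epsilon>) (x, r) \<le> objective (CC_MIBP D \<epsilon>) (x, s)"
      using linear_model_solution_from_CC_MIBP[OF assms(1,6,7)] by (cases s) (blast intro: eq_refl)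
  qed
  then show ?thesis
    by (simp add: valid_formulation_def theta_def)
qed

end
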